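(* Let $X$ be a weakly countably compact metrizable space, let $\alpha$ be an ordinal, let $\iota=\{\langle x,x\rangle:x\in X\}$, and let $f\neq\iota$ be a V-relation on $X$. Then the exact Mahavier product $\mathbf{M}\langle X,f,\alpha\rangle$ contains a subspace homeomorphic to $\alpha+1$ (with its order topology); therefore, $\mathbf{M}\langle X,f,\alpha\rangle$ is metrizable if and only if $\alpha$ is countable.
   Context: A space is weakly countably compact if every infinite subset has a limit point. For a relation $f\subseteq X^2$ and $x\in X$, $f(x)=\{y\in X:\langle x,y\rangle\in f\}$; $f^2=f\circ f$ is the relation with $f^2(x)=\bigcup_{y\in f(x)}f(y)$. A relation $f\subseteq X^2$ is idempotent if $f^2=f$; serial if $f(x)\neq\emptyset$ for all $x\in X$; USC if it is serial and is a closed subset of $X\times X$; surjective if for every $y\in X$ there is $x\in X$ with $\langle x,y\rangle\in f$. A V-relation on $X$ is a USC idempotent surjective relation $f\subseteq X^2$. An ordinal $\alpha=\{\beta:\beta<\alpha\}$ carries its usual linear order. The Mahavier product $\mathbf{M}\langle X,f,\alpha\rangle$ (with all factor spaces equal to $X$, bonding relations $f_{\beta,\gamma}=f$ for $\beta<\gamma<\alpha$, and $f_{\beta,\beta}=\iota$) is $$\mathbf{M}\langle X,f,\alpha\rangle=\{\mathbf{x}\in X^\alpha:\ \mathbf{x}(\beta)\in f(\mathbf{x}(\gamma))\text{ for all }\beta<\gamma<\alpha\},$$ with the subspace topology from the product topology on $X^\alpha$. A Mahavier product is exact if its bonding relations satisfy $f_{\beta,\delta}=f_{\beta,\gamma}\circ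 f_{\gamma,\delta}$ for all $\beta\le\gamma\le\delta$; this holds automatically here since $f$ is idempotent. *)

theory Defs
  imports "HOL-Analysis.Analysis"
begin

definition weakly_countably_compact_space :: "'a topology \<Rightarrow> bool" where
  "weakly_countably_compact_space X \<longleftrightarrow>
     (\<forall>S. S \<subseteq> topspace X \<and> infinite S \<longrightarrow> X derived_set_of S \<noteq> {})"

text \<open>For a relation \<open>f\<close>, the value \<open>f(x)\<close> is the image \<open>f `` {x}\<close>. The set-valued composition
  \<open>f \<circ> g\<close>, with \<open>(f \<circ> g)(x) = \<Union>{f(y) | y \<in> g(x)}\<close>, is therefore \<open>g O f\<close>.\<close>

definition serial_relation :: "'a topology \<Rightarrow> 'a rel \<Rightarrow> bool" where
  "serial_relation X f \<longleftrightarrow> (\<forall>x\<in>topspace X. f `` {x} \<noteq> {})"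

definition USC_relation :: "'a topology \<Rightarrow> 'a rel \<Rightarrow> bool" where
  "USC_relation X f \<longleftrightarrow> serial_relation X f \<and> closedin (prod_topology X X) f"

definition idempotent_relation :: "'a rel \<Rightarrow> bool" where
  "idempotent_relation f \<longleftrightarrow> f O f = f"

definition surjective_relation :: "'a topology \<Rightarrow> 'a rel \<Rightarrow> bool" where
  "surjective_relation X f \<longleftrightarrow> (\<forall>y\<in>topspace X. \<exists>x\<in>topspace X. (x, y) \<in> f)"

definition V_relation :: "'a topology \<Rightarrow> 'a rel \<Rightarrow> bool" where
  "V_relation X f \<longleftrightarrow>
     f \<subseteq> topspace X \<times> topspace X \<and>
     USC_relation X f \<and> idempotent_relation f \<and> surjective_relation X f"

text \<open>An ordinal is given by a well-order \<open>r\<close> of that order type, in the reflexive sense of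
  \<open>Well_order r\<close>; its elements are the members of \<open>Field r\<close>, and \<open>\<beta> < \<gamma>\<close> is \<open>\<beta> \<in> underS r \<gamma>\<close>.
  The empty relation represents the ordinal \<open>0\<close>.\<close>

definition mahavier_product ::
  "'a topology \<Rightarrow> ('b \<Rightarrow> 'b \<Rightarrow> 'a rel) \<Rightarrow> 'b rel \<Rightarrow> ('b \<Rightarrow> 'a) topology" where
  "mahavier_product X F r =
     subtopology (product_topology (\<lambda>_. X) (Field r))
       {x. \<forall>\<gamma>\<in>Field r. \<forall>\<beta>\<in>underS r \<gamma>. x \<beta> \<in> F \<beta> \<gamma> `` {x \<gamma>}}"

definition exact_bonding :: "('b \<Rightarrow> 'b \<Rightarrow> 'a rel) \<Rightarrow> 'b rel \<Rightarrow> bool" where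
  "exact_bonding F r \<longleftrightarrow>
     (\<forall>\<beta> \<gamma> \<delta>. (\<beta>, \<gamma>) \<in> r \<and> (\<gamma>, \<delta>) \<in> r \<longrightarrow> F \<beta> \<delta> = F \<gamma> \<delta> O F \<beta> \<gamma>)"

definition single_bonding :: "'a topology \<Rightarrow> 'a rel \<Rightarrow> 'b \<Rightarrow> 'b \<Rightarrow> 'a rel" where
  "single_bonding X f \<beta> \<gamma> = (if \<beta> = \<gamma> then Id_on (topspace X) else f)"

lemma exact_single_bonding:
  assumes "V_relation X f" and "Well_order r"
  shows "exact_bonding (single_bonding X f) r"
proof -
  have f: "f \<subseteq> topspace X \<times> topspace X" "f O f = f"
    using assms(1) by (auto simp: V_relation_def idempotent_relation_def)
  have "antisym r"
    using assms(2) by (simp add: order_on_defs)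
  moreover have "Id_on (topspace X) O f = f" "f O Id_on (topspace X) = f"
    using f(1) by auto
  moreover have "Id_on (topspace X) O Id_on (topspace X) = Id_on (topspace X)"
    by auto
  ultimately show ?thesis
    using f(2) by (auto simp: exact_bonding_def single_bonding_def dest: antisymD)
qed

text \<open>The successor \<open>r + 1\<close> adds the new greatest element \<open>None\<close>.\<close>

definition ord_succ :: "'b rel \<Rightarrow> 'b option rel" where
  "ord_succ r = {(Some a, Some b) | a b. (a, b) \<in> r} \<union> insert None (Some ` Field r) \<times> {None}"

lemma Field_ord_succ: "Field (ord_succ r) = insert None (Some ` Field r)"
  by (auto simp: ord_succ_def Field_def)

text \<open>The open rays, together with the whole space, form a subbase; the whole space is needed for
  the one-point order.\<close>

definition order_topology_of :: "'b rel \<Rightarrow> 'b topology" where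
  "order_topology_of r =
     topology_generated_by ({Field r} \<union> underS r ` Field r \<union> aboveS r ` Field r)"

lemma topspace_order_topology_of: "topspace (order_topology_of r) = Field r"
  by (auto simp: order_topology_of_def underS_def aboveS_def Field_def)

end

theory Submission
  imports Defs
begin

text \<open>
  The relation \<open>f\<close> is transitive, because it is idempotent. Everything rests on two distinct points
  \<open>a\<close> and \<open>b\<close> with \<open>(a, a)\<close>, \<open>(a, b)\<close> and \<open>(b, b)\<close> in \<open>f\<close>. To find them, take \<open>(x, y) \<in> f\<close> with
  \<open>x \<noteq> y\<close>; there is such a pair because a serial relation contained in the identity is the
  identity. Following \<open>f\<close> forwards from \<open>y\<close> produces a sequence that repeats a value or has a
  limit point; by transitivity and closedness this is a point \<open>b\<close> with \<open>(b, b) \<in> f\<close>. Following \<open>f\<close> backwards from \<open>x\<close> produces such a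
  point \<open>a\<close> (\<open>transitive_relation_reaches_loop\<close>). Now \<open>a\<close> leads to \<open>x\<close>, \<open>x\<close> to \<open>y\<close> and \<open>y\<close> to \<open>b\<close>.
  If \<open>a \<noteq> b\<close>, this is the pair; if \<open>a = b\<close>, all these points lie on a cycle, and \<open>x\<close>, \<open>y\<close> is the pair
  (\<open>V_relation_related_loops\<close>).

  A sequence indexed by \<open>\<alpha>\<close> that takes the value \<open>b\<close> below some \<open>\<delta> \<le> \<alpha>\<close> and \<open>a\<close> from \<open>\<delta>\<close> on
  belongs to the Mahavier product. The coordinate \<open>\<beta>\<close> of this sequence, as a function of \<open>\<delta>\<close>, only
  tells whether \<open>\<delta> \<le> \<beta>\<close> or \<open>\<delta> > \<beta>\<close>. Both sets of \<open>\<delta>\<close> are open in \<open>\<alpha> + 1\<close>, and these sets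
  generate its order topology, so the sequences form a copy of \<open>\<alpha> + 1\<close>
  (\<open>step_points_homeomorphic_ord_succ\<close>).

  A countable product of metrizable spaces is metrizable. Conversely, if the Mahavier product is
  metrizable, then \<open>\<alpha> + 1\<close> is first countable. Were \<open>\<alpha>\<close> uncountable, \<open>\<alpha> + 1\<close> would contain a
  least element with uncountably many predecessors, that is \<open>\<omega>\<^sub>1\<close>, which has no countable
  neighbourhood base (\<open>first_countable_order_topology_imp_countable_underS\<close>).
\<close>

section \<open>Related loops of a closed transitive relation\<close>

lemma closedin_relation_sections:
  assumes "closedin (prod_topology X Y) f"
  shows "x \<in> topspace X \<Longrightarrow> closedin Y (f `` {x})"
    and "y \<in> topspace Y \<Longrightarrow> closedin X (f\<inverse> `` {y})"
proof -
  have f: "f \<subseteq> topspace X \<times> topspace Y"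
    using closedin_subset[OF assms] by simp
  show "closedin Y (f `` {x})" if "x \<in> topspace X"
  proof -
    have "continuous_map Y (prod_topology X Y) (\<lambda>y. (x, y))"
      using that by (auto intro: continuous_intros)
    then have "closedin Y {y \<in> topspace Y. (x, y) \<in> f}"
      using assms by (rule closedin_continuous_map_preimage)
    moreover have "{y \<in> topspace Y. (x, y) \<in> f} = f `` {x}"
      using f by auto
    ultimately show ?thesis by simp
  qed
  show "closedin X (f\<inverse> `` {y})" if "y \<in> topspace Y"
  proof -
    have "continuous_map X (prod_topology X Y) (\<lambda>x. (x, y))"
      using that by (auto intro: continuous_intros)
    then have "closedin X {x \<in> topspace X. (x, y) \<in> f}"
      using assms by (rule closedin_continuous_map_preimage)
    moreover have "{x \<in> topspace X. (x, y) \<in> f} = f\<inverse> `` {y}"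
      using f by auto
    ultimately show ?thesis by simp
  qed
qed

text \<open>
  A forward chain from \<open>x\<close> either repeats a value, which is then related to itself by transitivity,
  or has a limit point \<open>l\<close>. In a T1 space \<open>l\<close> is a limit point of every tail of the chain. Each tail
  lies in the closed forward section of the preceding entry, so all entries are related to \<open>l\<close>. The
  whole chain thus lies in the closed backward section of \<open>l\<close>, which therefore contains \<open>l\<close>.
  Closedness enters only through the sections, so the lemma applies to a relation and to its converse.
\<close>

lemma transitive_relation_reaches_loop:
  assumes wcc: "weakly_countably_compact_space X" and t1: "t1_space X"
    and sub: "g \<subseteq> topspace X \<times> topspace X" and "trans g"
    and serial: "serial_relation X g"
    and cl: "\<And>z. z \<in> topspace X \<Longrightarrow> closedin X (g `` {z})"
    and cl': "\<And>z. z \<in> topspace X \<Longrightarrow> closedin X (g\<inverse> `` {z})"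
    and x: "x \<in> topspace X"
  obtains y where "(x, y) \<in> g \<or> x = y" and "(y, y) \<in> g"
proof -
  have "\<exists>s :: nat \<Rightarrow> 'a. \<forall>n. (s n \<in> topspace X \<and> (n = 0 \<longrightarrow> s n = x)) \<and> (s n, s (Suc n)) \<in> g"
  proof (rule dependent_nat_choice)
    show "\<exists>y. y \<in> topspace X \<and> ((0::nat) = 0 \<longrightarrow> y = x)"
      using x by blast
    fix y and n :: nat assume "y \<in> topspace X \<and> (n = 0 \<longrightarrow> y = x)"
    then show "\<exists>z. (z \<in> topspace X \<and> (Suc n = 0 \<longrightarrow> z = x)) \<and> (y, z) \<in> g"
      using serial sub by (fastforce simp: serial_relation_def)
  qed
  then obtain s :: "nat \<Rightarrow> 'a" where s0: "s 0 = x" and top: "\<And>n. s n \<in> topspace X"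
    and step: "\<And>n. (s n, s (Suc n)) \<in> g"
    by blast
  have chain: "(s i, s j) \<in> g" if "i < j" for i j
    using that
  proof (induction rule: less_Suc_induct)
    case (1 i) show ?case by (rule step)
  next
    case (2 i j k) then show ?case using \<open>trans g\<close> by (blast dest: transD)
  qed
  show thesis
  proof (cases "finite (range s)")
    case True
    then have "\<not> inj s"
      using finite_imageD infinite_UNIV_nat by blast
    then obtain i j where "s i = s j" "i < j"
      by (metis injI linorder_neqE_nat)
    then have "(s i, s i) \<in> g"
      using chain by metis
    then show thesis
      using that chain[of 0 i] s0 by (metis neq0_conv)
  next
    case False
    moreover have "range s \<subseteq> topspace X"
      using top by auto
    ultimately obtain l where l: "l \<in> X derived_set_of range s"
      using wcc by (auto simp: weakly_countably_compact_space_def)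
    then have ltop: "l \<in> topspace X"
      by (simp add: in_derived_set_of)
    \<comment> \<open>Finitely many entries contribute no limit point, so \<open>l\<close> comes from the entries after \<open>i\<close>.\<close>
    have to_l: "(s i, l) \<in> g" for i
    proof -
      have "range s = s ` {..i} \<union> s ` {i<..}"
        by force
      moreover have "X derived_set_of (s ` {..i}) = {}"
        using t1 by (simp add: t1_space_derived_set_of_finite)
      ultimately have "l \<in> X derived_set_of (s ` {i<..})"
        using l by (simp add: derived_set_of_Un)
      also have "\<dots> \<subseteq> X derived_set_of (g `` {s i})"
        using chain by (intro derived_set_of_mono) auto
      also have "\<dots> \<subseteq> g `` {s i}"
        using cl[OF top] by (simp add: closedin_contains_derived_set)
      finally show ?thesis by simp
    qed
    have "l \<in> X derived_set_of (g\<inverse> `` {l})"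
      using l to_l derived_set_of_mono[of "range s" "g\<inverse> `` {l}" X] by blast
    then have "(l, l) \<in> g"
      using cl'[OF ltop] by (auto simp: closedin_contains_derived_set)
    then show thesis
      using that to_l[of 0] s0 by metis
  qed
qed

text \<open>
  Loops \<open>a\<close> and \<open>b\<close> are found behind \<open>x\<close> and ahead of \<open>y\<close> for a pair \<open>x \<noteq> y\<close> in \<open>f\<close>. Should they
  coincide, then \<open>x\<close> and \<open>y\<close> lie on a cycle and are loops themselves.
\<close>

lemma V_relation_related_loops:
  assumes wcc: "weakly_countably_compact_space X" and t1: "t1_space X"
    and V: "V_relation X f" and nontriv: "f \<noteq> Id_on (topspace X)"
  obtains a b where "a \<noteq> b" "(a, a) \<in> f" "(a, b) \<in> f" "(b, b) \<in> f"
proof -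
  have sub: "f \<subseteq> topspace X \<times> topspace X" and tr: "trans f"
    and serial: "serial_relation X f" and clo: "closedin (prod_topology X X) f"
    and surj: "surjective_relation X f"
    using V by (auto simp: V_relation_def USC_relation_def idempotent_relation_def intro: transI)
  note sections = closedin_relation_sections[OF clo]
  have "serial_relation X (f\<inverse>)"
    using surj by (auto simp: serial_relation_def surjective_relation_def)
  have "\<not> f \<subseteq> Id"
  proof
    assume "f \<subseteq> Id"
    then have "f = Id_on (topspace X)"
      using serial sub by (fastforce simp: serial_relation_def)
    with nontriv show False ..
  qed
  then obtain x y where xy: "(x, y) \<in> f" "x \<noteq> y"
    by auto
  then have top: "x \<in> topspace X" "y \<in> topspace X"
    using sub by auto
  obtain b where b: "(y, b) \<in> f \<or> y = b" "(b, b) \<in> f"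
    using transitive_relation_reaches_loop[OF wcc t1 sub tr serial sections top(2)] .
  obtain a where a: "(x, a) \<in> f\<inverse> \<or> x = a" "(a, a) \<in> f\<inverse>"
  proof (rule transitive_relation_reaches_loop[OF wcc t1, of "f\<inverse>" x])
    show "f\<inverse> \<subseteq> topspace X \<times> topspace X" "trans (f\<inverse>)" using sub tr by auto
    show "closedin X (f\<inverse> `` {z})" "closedin X ((f\<inverse>)\<inverse> `` {z})" if "z \<in> topspace X" for z
      using sections that by auto
  qed (use top \<open>serial_relation X (f\<inverse>)\<close> in auto)
  show thesis
  proof (cases "a = b")
    case False
    have "(a, b) \<in> f"
      using a b xy tr by (auto dest: transD)
    with False a b that show thesis by auto
  next
    case True
    have "(x, x) \<in> f" "(y, y) \<in> f"
      using a b xy tr True by (auto dest: transD)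
    with xy that show thesis by auto
  qed
qed

section \<open>The order topology of a well-order\<close>

lemma Well_order_ord_succ:
  assumes "Well_order r"
  shows "Well_order (ord_succ r)"
proof -
  have lin: "Linear_order r"
    using assms by (simp add: well_order_on_def)
  have fld: "a \<in> Field r" "b \<in> Field r" if "(a, b) \<in> r" for a b
    using that by (auto simp: Field_def)
  have "Linear_order (ord_succ r)"
    unfolding order_on_defs
  proof (intro conjI)
    show "ord_succ r \<subseteq> Field (ord_succ r) \<times> Field (ord_succ r)"
      by (auto simp: Field_def)
    show "refl_on (Field (ord_succ r)) (ord_succ r)"
      unfolding Field_ord_succ using lin by (auto simp: refl_on_def order_on_defs ord_succ_def)
    show "trans (ord_succ r)"
      using lin fld by (intro transI) (auto simp: order_on_defs ord_succ_def dest: transD)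
    show "antisym (ord_succ r)"
      using lin by (intro antisymI) (auto simp: order_on_defs ord_succ_def dest: antisymD)
    show "total_on (Field (ord_succ r)) (ord_succ r)"
      unfolding Field_ord_succ using lin by (auto simp: total_on_def order_on_defs ord_succ_def)
  qed
  moreover have "\<exists>m\<in>A. \<forall>a\<in>A. (m, a) \<in> ord_succ r"
    if A: "A \<subseteq> Field (ord_succ r)" "A \<noteq> {}" for A
  proof (cases "A \<subseteq> {None}")
    case True
    then have "A = {None}" using A by auto
    then show ?thesis by (auto simp: ord_succ_def)
  next
    case False
    let ?B = "{b. Some b \<in> A}"
    have "?B \<subseteq> Field r" "?B \<noteq> {}"
      using A False by (auto simp: Field_ord_succ)
    then obtain m where m: "m \<in> ?B" "\<forall>b\<in>?B. (m, b) \<in> r"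
      using assms lin by (metis (no_types, lifting) Linear_order_Well_order_iff)
    have "(Some m, a) \<in> ord_succ r" if "a \<in> A" for a
      using that m \<open>?B \<subseteq> Field r\<close> by (cases a) (auto simp: ord_succ_def)
    then show ?thesis using m by blast
  qed
  ultimately show ?thesis
    by (simp add: Linear_order_Well_order_iff)
qed

lemma underS_linear:
  assumes "Linear_order R" "a \<in> Field R" "b \<in> Field R"
  shows "a \<in> underS R b \<longleftrightarrow> b \<notin> under R a"
  using assms by (cases "a = b")
    (auto simp: underS_def under_def order_on_defs refl_on_def total_on_def dest: antisymD)

lemma openin_order_topology_rays:
  assumes "d \<in> Field R"
  shows "openin (order_topology_of R) (underS R d)" "openin (order_topology_of R) (aboveS R d)"
  using assms unfolding order_topology_of_def by (auto intro: topology_generated_by_Basis)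

text \<open>
  If \<open>d\<close> is not the greatest element, it has an immediate successor \<open>c\<close>, and the closed ray up to
  \<open>d\<close> is the open ray below \<open>c\<close>.
\<close>

lemma openin_order_topology_under:
  assumes "Well_order R" and "aboveS R d \<noteq> {}"
  shows "openin (order_topology_of R) (under R d)"
proof -
  have lin: "Linear_order R"
    using assms by (simp add: well_order_on_def)
  have "aboveS R d \<subseteq> Field R"
    by (auto simp: aboveS_def Field_def)
  then obtain c where c: "c \<in> aboveS R d" "\<forall>e\<in>aboveS R d. (c, e) \<in> R"
    using assms lin by (metis Linear_order_Well_order_iff)
  then have "c \<in> Field R" "d \<in> Field R" by (auto simp: aboveS_def Field_def)
  have "under R d = underS R c"
  proof (intro set_eqI iffI)
    fix e assume "e \<in> under R d"
    then show "e \<in> underS R c"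
      using c lin unfolding order_on_defs
      by (auto simp: under_def underS_def aboveS_def dest: transD antisymD)
  next
    fix e assume e: "e \<in> underS R c"
    then have "e \<in> Field R" by (auto simp: underS_def Field_def)
    show "e \<in> under R d"
    proof (rule ccontr)
      assume "e \<notin> under R d"
      then have "d \<in> underS R e"
        using underS_linear lin \<open>e \<in> Field R\<close> \<open>d \<in> Field R\<close> by metis
      then have "(c, e) \<in> R"
        using c by (auto simp: underS_def aboveS_def)
      then show False
        using e lin by (auto simp: underS_def order_on_defs dest: antisymD)
    qed
  qed
  then show ?thesis
    using openin_order_topology_rays \<open>c \<in> Field R\<close> by metis
qed

text \<open>
  The property passes from the subbase to finite intersections, because of two half-open intervals
  ending at \<open>d\<close> the shorter lies in the longer. For rays that contain all of \<open>under R d\<close> any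
  predecessor of \<open>d\<close> serves as left end; this is why \<open>d\<close> must not be the least element.
\<close>

lemma order_topology_left_neighbourhood:
  assumes "Linear_order R" and "underS R d \<noteq> {}"
    and "openin (order_topology_of R) U" and "d \<in> U"
  shows "\<exists>c\<in>underS R d. aboveS R c \<inter> under R d \<subseteq> U"
proof -
  have tr: "trans R" and as: "antisym R"
    using assms(1) by (auto simp: order_on_defs)
  have "generate_topology_on ({Field R} \<union> underS R ` Field R \<union> aboveS R ` Field R) U"
    using assms(3) unfolding order_topology_of_def by (rule openin_topology_generated_by)
  then show ?thesis
    using \<open>d \<in> U\<close>
  proof induction
    case (Int V W)
    then obtain v w where vw: "v \<in> underS R d" "aboveS R v \<inter> under R d \<subseteq> V"
       "w \<in> underS R d" "aboveS R w \<inter> under R d \<subseteq> W"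
      by blast
    have "(v, w) \<in> R \<or> (w, v) \<in> R"
    proof -
      have "v \<in> Field R" "w \<in> Field R"
        using vw by (auto simp: underS_def Field_def)
      then show ?thesis
        using assms(1) by (cases "v = w") (auto simp: order_on_defs total_on_def refl_on_def)
    qed
    moreover have "aboveS R q \<subseteq> aboveS R p" if "(p, q) \<in> R" for p q
      using that tr as by (auto simp: aboveS_def dest: transD antisymD)
    ultimately have "aboveS R w \<subseteq> aboveS R v \<or> aboveS R v \<subseteq> aboveS R w"
      by blast
    with vw show ?case by blast
  next
    case (UN K)
    then show ?case by blast
  next
    case (Basis V)
    obtain c where c: "c \<in> underS R d"
      using assms(2) by blast
    from Basis.hyps consider "V = Field R" | e where "V = underS R e" | e where "V = aboveS R e"
      by blast
    then show ?case
    proof cases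
      case 1
      have "under R d \<subseteq> Field R"
        by (auto simp: under_def Field_def)
      with 1 c show ?thesis by blast
    next
      case 2
      then have "under R d \<subseteq> V"
        using Basis.prems tr as by (auto simp: under_def underS_def dest: transD antisymD)
      with c show ?thesis by blast
    next
      case 3
      then have "e \<in> underS R d"
        using Basis.prems by (auto simp: aboveS_def underS_def)
      with 3 show ?thesis by blast
    qed
  qed simp
qed

text \<open>
  This is the argument that \<open>\<omega>\<^sub>1\<close> is not a limit of countably many smaller ordinals. The least
  point \<open>m\<close> with uncountably many predecessors plays the role of \<open>\<omega>\<^sub>1\<close>: the left ends of intervals
  inside the members of a countable neighbourhood base would be cofinal below \<open>m\<close>, while each of them
  has only countably many predecessors.
\<close>

lemma first_countable_order_topology_imp_countable_underS:
  assumes wo: "Well_order R" and fc: "first_countable (order_topology_of R)" and "d \<in> Field R"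
  shows "countable (underS R d)"
proof (rule ccontr)
  assume unc: "uncountable (underS R d)"
  have lin: "Linear_order R"
    using wo by (simp add: well_order_on_def)
  let ?A = "{e \<in> Field R. uncountable (underS R e)}"
  have "?A \<subseteq> Field R" "?A \<noteq> {}"
    using unc \<open>d \<in> Field R\<close> by auto
  then obtain m where m: "m \<in> Field R" "uncountable (underS R m)" "\<forall>e\<in>?A. (m, e) \<in> R"
    using wo lin by (metis (no_types, lifting) Linear_order_Well_order_iff mem_Collect_eq)
  have small: "countable (under R e)" if "e \<in> underS R m" for e
  proof -
    have "e \<in> Field R"
      using that by (auto simp: underS_def Field_def)
    moreover have "(m, e) \<notin> R"
      using that lin by (auto simp: underS_def order_on_defs dest: antisymD)
    ultimately have "countable (underS R e)"
      using m by blast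
    moreover have "under R e \<subseteq> insert e (underS R e)"
      by (auto simp: under_def underS_def)
    ultimately show ?thesis
      by (meson countable_insert countable_subset)
  qed
  have ne: "underS R m \<noteq> {}"
    using m(2) by auto
  obtain \<B> where \<B>: "countable \<B>" "\<And>V. V \<in> \<B> \<Longrightarrow> openin (order_topology_of R) V"
    "\<And>U. openin (order_topology_of R) U \<Longrightarrow> m \<in> U \<Longrightarrow> \<exists>V\<in>\<B>. m \<in> V \<and> V \<subseteq> U"
    using fc m(1) unfolding first_countable_def topspace_order_topology_of by metis
  define \<C> where "\<C> = {V \<in> \<B>. m \<in> V}"
  have "\<forall>V\<in>\<C>. \<exists>c\<in>underS R m. aboveS R c \<inter> under R m \<subseteq> V"
    using order_topology_left_neighbourhood[OF lin ne] \<B>(2) by (auto simp: \<C>_def)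
  then obtain c where c: "\<And>V. V \<in> \<C> \<Longrightarrow> c V \<in> underS R m"
    "\<And>V. V \<in> \<C> \<Longrightarrow> aboveS R (c V) \<inter> under R m \<subseteq> V"
    by metis
  have "underS R m \<subseteq> (\<Union>V\<in>\<C>. under R (c V))"
  proof
    fix e assume e: "e \<in> underS R m"
    then have eF: "e \<in> Field R"
      by (auto simp: underS_def Field_def)
    have "m \<in> aboveS R e"
      using e by (auto simp: underS_def aboveS_def)
    then obtain V where V: "V \<in> \<C>" "V \<subseteq> aboveS R e"
      using \<B>(3) openin_order_topology_rays(2)[OF eF] unfolding \<C>_def by blast
    have "e \<notin> aboveS R (c V) \<inter> under R m"
      using c(2) V by (auto simp: aboveS_def)
    then have "e \<notin> aboveS R (c V)"
      using e by (auto simp: underS_def under_def)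
    moreover have "c V \<in> Field R"
      using c(1) V by (auto simp: underS_def Field_def)
    ultimately have "e \<in> under R (c V)"
      using underS_linear[OF lin _ eF, of "c V"] by (auto simp: underS_def aboveS_def)
    with V show "e \<in> (\<Union>V\<in>\<C>. under R (c V))" by blast
  qed
  moreover have "countable (\<Union>V\<in>\<C>. under R (c V))"
    using small c(1) \<B>(1) by (intro countable_UN) (auto simp: \<C>_def)
  ultimately show False
    using m(2) by (meson countable_subset)
qed

section \<open>Step functions in the Mahavier product\<close>

text \<open>
  The value is \<open>b\<close> strictly below \<open>d\<close> and \<open>a\<close> from \<open>d\<close> on. Since \<open>d\<close> may be the top element
  \<open>None\<close>, which stands for the constant \<open>b\<close>, indices are compared with \<open>d\<close> in \<open>ord_succ r\<close>.
\<close>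

definition step_point :: "'b rel \<Rightarrow> 'a \<Rightarrow> 'a \<Rightarrow> 'b option \<Rightarrow> 'b \<Rightarrow> 'a" where
  "step_point r a b d = (\<lambda>\<beta>\<in>Field r. if (d, Some \<beta>) \<in> ord_succ r then a else b)"

lemma step_point_eq_iff:
  assumes "Well_order r" "a \<noteq> b" "d \<in> Field (ord_succ r)" "\<beta> \<in> Field r"
  shows "step_point r a b d \<beta> = a \<longleftrightarrow> d \<in> under (ord_succ r) (Some \<beta>)"
    and "step_point r a b d \<beta> = b \<longleftrightarrow> d \<in> aboveS (ord_succ r) (Some \<beta>)"
proof -
  show 1: "step_point r a b d \<beta> = a \<longleftrightarrow> d \<in> under (ord_succ r) (Some \<beta>)"
    using assms by (auto simp: step_point_def under_def)
  have "d \<in> aboveS (ord_succ r) (Some \<beta>) \<longleftrightarrow> Some \<beta> \<in> underS (ord_succ r) d"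
    by (auto simp: aboveS_def underS_def)
  also have "\<dots> \<longleftrightarrow> d \<notin> under (ord_succ r) (Some \<beta>)"
    using assms Well_order_ord_succ[OF assms(1)]
    by (intro underS_linear) (auto simp: Field_ord_succ well_order_on_def)
  also have "\<dots> \<longleftrightarrow> step_point r a b d \<beta> = b"
    using assms by (auto simp: step_point_def under_def)
  finally show "step_point r a b d \<beta> = b \<longleftrightarrow> d \<in> aboveS (ord_succ r) (Some \<beta>)" ..
qed

text \<open>
  A pair of indices \<open>\<beta> < \<gamma>\<close> gives the values \<open>(a, a)\<close>, \<open>(a, b)\<close> or \<open>(b, b)\<close> at \<open>(\<gamma>, \<beta>)\<close>: once the
  step function has reached \<open>a\<close> it stays there.
\<close>

lemma step_point_in_mahavier_product:
  assumes wo: "Well_order r" and f: "f \<subseteq> topspace X \<times> topspace X"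
    and ab: "(a, a) \<in> f" "(a, b) \<in> f" "(b, b) \<in> f"
  shows "step_point r a b d \<in> topspace (mahavier_product X (single_bonding X f) r)"
proof -
  have tr: "trans (ord_succ r)"
    using Well_order_ord_succ[OF wo] by (simp add: order_on_defs)
  have "a \<in> topspace X" "b \<in> topspace X"
    using ab f by auto
  moreover have "(step_point r a b d \<gamma>, step_point r a b d \<beta>) \<in> single_bonding X f \<beta> \<gamma>"
    if "\<gamma> \<in> Field r" "\<beta> \<in> underS r \<gamma>" for \<beta> \<gamma>
  proof -
    have "\<beta> \<in> Field r" "\<beta> \<noteq> \<gamma>" "(Some \<beta>, Some \<gamma>) \<in> ord_succ r"
      using that by (auto simp: underS_def Field_def ord_succ_def)
    moreover have "(d, Some \<gamma>) \<in> ord_succ r" if "(d, Some \<beta>) \<in> ord_succ r"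
      using that calculation(3) tr by (rule transD[rotated])
    ultimately show ?thesis
      using ab \<open>\<gamma> \<in> Field r\<close> by (auto simp: step_point_def single_bonding_def)
  qed
  ultimately show ?thesis
    by (auto simp: mahavier_product_def step_point_def PiE_iff)
qed

text \<open>
  Coordinates take only the values \<open>a\<close> and \<open>b\<close>, so \<open>step_point_eq_iff\<close> turns statements about
  coordinates into statements about rays. Continuity of the embedding needs the rays
  \<open>under (ord_succ r) (Some \<beta>)\<close> to be open, which holds because \<open>None\<close> lies above \<open>Some \<beta>\<close>.
  Continuity of the inverse uses the open conditions \<open>x \<beta> \<noteq> a\<close> and \<open>x \<beta> \<noteq> b\<close>, which cut out
  the strict upper and the closed lower ray at \<open>Some \<beta>\<close>.
\<close>

lemma step_points_homeomorphic_ord_succ: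
  assumes wo: "Well_order r" and t1: "t1_space X" and f: "f \<subseteq> topspace X \<times> topspace X"
    and ab: "a \<noteq> b" "(a, a) \<in> f" "(a, b) \<in> f" "(b, b) \<in> f"
  defines "M \<equiv> mahavier_product X (single_bonding X f) r"
  shows "subtopology M (step_point r a b ` Field (ord_succ r))
           homeomorphic_space order_topology_of (ord_succ r)"
proof -
  let ?R = "ord_succ r" and ?p = "step_point r a b"
  let ?S = "?p ` Field ?R" and ?T = "order_topology_of ?R"
  let ?MS = "subtopology M ?S"
  have woR: "Well_order ?R"
    using wo by (rule Well_order_ord_succ)
  then have lin: "Linear_order ?R"
    by (simp add: well_order_on_def)
  have topX: "a \<in> topspace X" "b \<in> topspace X"
    using ab f by auto
  have SM: "?S \<subseteq> topspace M"
    using step_point_in_mahavier_product[OF wo f ab(2-4)] by (auto simp: M_def)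
  then have topMS: "topspace ?MS = ?S"
    by auto
  note p_eq = step_point_eq_iff[OF wo ab(1)]
  have inj: "inj_on ?p (Field ?R)"
  proof (rule inj_onI, rule ccontr)
    fix d e assume de: "d \<in> Field ?R" "e \<in> Field ?R" "?p d = ?p e" "d \<noteq> e"
    have "\<not> ?p d = ?p e" if de: "d \<in> Field ?R" "e \<in> Field ?R" and less: "d \<in> underS ?R e" for d e
    proof -
      obtain \<beta> where \<beta>: "d = Some \<beta>" "\<beta> \<in> Field r"
        using de less by (auto simp: underS_def ord_succ_def Field_def)
      then have "?p d \<beta> = a" "?p e \<beta> = b"
        using p_eq de less lin
        by (auto simp: underS_def aboveS_def under_def order_on_defs refl_on_def)
      then show ?thesis using ab(1) by auto
    qed
    moreover have "d \<in> underS ?R e \<or> e \<in> underS ?R d"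
      using de lin by (auto simp: underS_def order_on_defs total_on_def)
    ultimately show False using de by metis
  qed
  have comp: "continuous_map ?T X (\<lambda>d. ?p d \<beta>)" if \<beta>: "\<beta> \<in> Field r" for \<beta>
    unfolding continuous_map_def topspace_order_topology_of
  proof (intro conjI allI impI)
    show "(\<lambda>d. ?p d \<beta>) \<in> Field ?R \<rightarrow> topspace X"
      using topX \<beta> by (auto simp: step_point_def)
    fix U assume "openin X U"
    have "None \<in> aboveS ?R (Some \<beta>)"
      using \<beta> by (auto simp: aboveS_def ord_succ_def)
    then have "openin ?T (under ?R (Some \<beta>))"
      using openin_order_topology_under[OF woR] by blast
    moreover have "openin ?T (aboveS ?R (Some \<beta>))"
      using \<beta> by (intro openin_order_topology_rays) (auto simp: Field_ord_succ)
    moreover have "{d \<in> Field ?R. ?p d \<beta> \<in> U} =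
        (if a \<in> U then under ?R (Some \<beta>) else {}) \<union> (if b \<in> U then aboveS ?R (Some \<beta>) else {})"
      (is "?L = ?P")
    proof -
      have "under ?R (Some \<beta>) \<subseteq> Field ?R" "aboveS ?R (Some \<beta>) \<subseteq> Field ?R"
        by (auto simp: under_def aboveS_def Field_def)
      moreover have "?p d \<beta> = a \<or> ?p d \<beta> = b" for d
        using \<beta> by (simp add: step_point_def)
      ultimately have "d \<in> ?L \<longleftrightarrow> d \<in> ?P" for d
        using p_eq[OF _ \<beta>, of d] by (cases "d \<in> Field ?R") (auto split: if_splits)
      then show ?thesis by blast
    qed
    ultimately show "openin ?T {d \<in> Field ?R. ?p d \<beta> \<in> U}"
      by auto
  qed
  have cont: "continuous_map ?T ?MS ?p"
    using comp SM
    by (auto simp: M_def mahavier_product_def continuous_map_in_subtopology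
        continuous_map_componentwise topspace_order_topology_of step_point_def)
  let ?q = "inv_into (Field ?R) ?p"
  have proj: "openin ?MS {x \<in> ?S. x \<beta> \<noteq> z}" if "\<beta> \<in> Field r" "z \<in> topspace X" for \<beta> z
  proof -
    have "continuous_map ?MS X (\<lambda>x. x \<beta>)"
      unfolding M_def mahavier_product_def
      by (intro continuous_map_from_subtopology continuous_map_product_projection that(1))
    moreover have "openin X (topspace X - {z})"
      using t1 unfolding t1_space_openin_delete_alt by (metis openin_topspace)
    ultimately have "openin ?MS {x \<in> topspace ?MS. x \<beta> \<in> topspace X - {z}}"
      by (rule openin_continuous_map_preimage)
    moreover have "{x \<in> topspace ?MS. x \<beta> \<in> topspace X - {z}} = {x \<in> ?S. x \<beta> \<noteq> z}"
      unfolding topMS using topX that by (auto simp: step_point_def)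
    ultimately show ?thesis by simp
  qed
  have "continuous_map ?MS ?T ?q"
    unfolding order_topology_of_def
  proof (rule continuous_on_generated_topo)
    have pre: "?q -` D \<inter> topspace ?MS = ?p ` D" if "D \<subseteq> Field ?R" for D
      unfolding topMS using that inj by (auto simp: inv_into_f_f subset_iff)
    have above: "openin ?MS (?p ` aboveS ?R d)" if d: "d \<in> Field ?R" for d
    proof (cases d)
      case None
      then have "aboveS ?R d = {}"
        by (auto simp: aboveS_def ord_succ_def)
      then show ?thesis by simp
    next
      case (Some \<beta>)
      then have \<beta>: "\<beta> \<in> Field r" using d by (auto simp: Field_ord_succ)
      have "?p ` aboveS ?R d = {x \<in> ?S. x \<beta> \<noteq> a}"
      proof -
        have "aboveS ?R d = {e \<in> Field ?R. ?p e \<beta> \<noteq> a}"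
        proof -
          have "aboveS ?R d \<subseteq> Field ?R" by (auto simp: aboveS_def Field_def)
          moreover have "?p e \<beta> \<noteq> a \<longleftrightarrow> ?p e \<beta> = b" for e
            using \<beta> ab(1) by (simp add: step_point_def)
          ultimately show ?thesis
            using p_eq(2)[OF _ \<beta>] Some by auto
        qed
        then show ?thesis by auto
      qed
      then show ?thesis using proj[OF \<beta> topX(1)] by simp
    qed
    have under: "openin ?MS (?p ` under ?R (Some \<beta>))" if \<beta>: "\<beta> \<in> Field r" for \<beta>
    proof -
      have "under ?R (Some \<beta>) = {e \<in> Field ?R. ?p e \<beta> \<noteq> b}"
      proof -
        have "under ?R (Some \<beta>) \<subseteq> Field ?R" by (auto simp: under_def Field_def)
        moreover have "?p e \<beta> \<noteq> b \<longleftrightarrow> ?p e \<beta> = a" for e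
          using \<beta> ab(1) by (simp add: step_point_def)
        ultimately show ?thesis
          using p_eq(1)[OF _ \<beta>] by auto
      qed
      then have "?p ` under ?R (Some \<beta>) = {x \<in> ?S. x \<beta> \<noteq> b}" by auto
      then show ?thesis using proj[OF \<beta> topX(2)] by simp
    qed
    \<comment> \<open>Every element below some \<open>d\<close> is of the form \<open>Some \<beta>\<close>, so a strict lower ray is a union of the
      closed lower rays just treated.\<close>
    have underS: "openin ?MS (?p ` underS ?R d)" for d
    proof -
      have "underS ?R d = (\<Union>\<beta>\<in>{\<beta>. Some \<beta> \<in> underS ?R d}. under ?R (Some \<beta>))" (is "_ = ?P")
      proof (intro set_eqI iffI)
        fix e assume e: "e \<in> underS ?R d"
        then obtain \<beta> where "e = Some \<beta>" "\<beta> \<in> Field r"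
          by (auto simp: underS_def ord_succ_def Field_def)
        moreover have "(e, e) \<in> ?R"
          using calculation lin by (auto simp: order_on_defs refl_on_def Field_ord_succ)
        ultimately show "e \<in> ?P" using e by (auto simp: under_def)
      next
        fix e assume "e \<in> ?P"
        then show "e \<in> underS ?R d"
          using lin by (auto simp: under_def underS_def order_on_defs dest: transD antisymD)
      qed
      then have "?p ` underS ?R d = (\<Union>\<beta>\<in>{\<beta>. Some \<beta> \<in> underS ?R d}. ?p ` under ?R (Some \<beta>))"
        by (metis image_UN)
      moreover have "\<beta> \<in> Field r" if "Some \<beta> \<in> underS ?R d" for \<beta>
        using that by (auto simp: underS_def ord_succ_def Field_def)
      ultimately show ?thesis using under by auto
    qed
    fix D assume D: "D \<in> {Field ?R} \<union> underS ?R ` Field ?R \<union> aboveS ?R ` Field ?R"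
    then have "D \<subseteq> Field ?R"
      by (auto simp: underS_def aboveS_def Field_def)
    moreover have "openin ?MS (?p ` D)"
      using D above underS openin_topspace[of ?MS] unfolding topMS by auto
    ultimately show "openin ?MS (?q -` D \<inter> topspace ?MS)"
      by (simp only: pre)
  next
    show "?q ` topspace ?MS \<subseteq> \<Union> ({Field ?R} \<union> underS ?R ` Field ?R \<union> aboveS ?R ` Field ?R)"
      unfolding topMS by (auto simp: inv_into_f_f[OF inj])
  qed
  with cont have "homeomorphic_maps ?MS ?T ?q ?p"
    unfolding homeomorphic_maps_def topMS topspace_order_topology_of
    by (auto simp: inv_into_f_f[OF inj])
  then show ?thesis
    unfolding homeomorphic_space_def by blast
qed

section \<open>Metrizability of the Mahavier product\<close>

theorem corollary27:
  fixes X :: "'a topology" and f :: "'a rel" and r :: "'b rel"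
  assumes "weakly_countably_compact_space X"
    and "metrizable_space X"
    and "Well_order r"
    and "V_relation X f"
    and "f \<noteq> Id_on (topspace X)"
  shows "(\<exists>S \<subseteq> topspace (mahavier_product X (single_bonding X f) r).
            subtopology (mahavier_product X (single_bonding X f) r) S
              homeomorphic_space order_topology_of (ord_succ r)) \<and>
         (metrizable_space (mahavier_product X (single_bonding X f) r) \<longleftrightarrow> countable (Field r))"
proof -
  let ?M = "mahavier_product X (single_bonding X f) r" and ?R = "ord_succ r"
  have t1: "t1_space X"
    using assms(2) by (rule metrizable_imp_t1_space)
  have f: "f \<subseteq> topspace X \<times> topspace X"
    using assms(4) by (simp add: V_relation_def)
  obtain a b where ab: "a \<noteq> b" "(a, a) \<in> f" "(a, b) \<in> f" "(b, b) \<in> f"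
    using V_relation_related_loops[OF assms(1) t1 assms(4,5)] .
  let ?S = "step_point r a b ` Field ?R"
  have S: "?S \<subseteq> topspace ?M"
    using step_point_in_mahavier_product[OF assms(3) f ab(2-4)] by blast
  have homeo: "subtopology ?M ?S homeomorphic_space order_topology_of ?R"
    using step_points_homeomorphic_ord_succ[OF assms(3) t1 f ab] .
  have "countable (Field r)" if "metrizable_space ?M"
  proof -
    have "metrizable_space (order_topology_of ?R)"
      using metrizable_space_subtopology[OF that] homeomorphic_metrizable_space[OF homeo] by metis
    then have "countable (underS ?R None)"
      by (intro first_countable_order_topology_imp_countable_underS
          metrizable_imp_first_countable Well_order_ord_succ assms(3))
        (simp_all add: Field_ord_succ)
    moreover have "underS ?R None = Some ` Field r"
      by (auto simp: underS_def ord_succ_def)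
    ultimately show ?thesis
      by (simp add: countable_image_inj_eq)
  qed
  moreover have "metrizable_space ?M" if "countable (Field r)"
  proof -
    have "countable {i \<in> Field r. \<not> (\<exists>a. topspace X \<subseteq> {a})}"
      using that by (rule countable_subset[rotated]) auto
    then show ?thesis
      unfolding mahavier_product_def using assms(2)
      by (intro metrizable_space_subtopology) (simp add: metrizable_space_product_topology)
  qed
  moreover have "\<exists>S \<subseteq> topspace ?M. subtopology ?M S homeomorphic_space order_topology_of ?R"
    by (rule exI[of _ ?S]) (simp only: S homeo simp_thms)
  ultimately show ?thesis
    by metis
qed

end
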